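(* Let $f\in\mathcal{S}(\Omega)$ with $\Omega=\Omega_D$. Then $$V(N(f))=\bigcup_{V(f)\cap\mathbb{S}_x\neq\emptyset}\mathbb{S}_x\ \cup\bigcup_{\mathbb{S}_x\cap\mathbb{H}\subseteq V({}^{\pi}\!f)}\mathbb{S}_x,$$ where in both unions $x$ ranges over the points of $\Omega$ with the indicated property. Moreover, for each $x\in\Omega\setminus\mathbb{R}$ the normal function $N(f)$ vanishes identically in $\mathbb{S}_x$ if, and only if, either $f$ has a unique zero in $\mathbb{S}_x$ or ${}^{\pi}\!f$ vanishes identically in $\mathbb{S}_x\cap\mathbb{H}$.
   Context: $\mathbb{H}$ is the algebra of quaternions, with conjugation $q\mapsto q^c$. The dual quaternions are $\mathbb{DH}=\mathbb{H}+\epsilon\mathbb{H}$, with elements $h=h_1+\epsilon h_2$, componentwise addition and product $hh'=h_1h'_1+\epsilon(h_1h'_2+h_2h'_1)$; $\pi(h)=h_1$ is the primal part. Put $h^c=h_1^c+\epsilon h_2^c$, $t(h)=h+h^c$, $n(h)=hh^c$. For $A=\mathbb{H}$ or $\mathbb{DH}$ let $\mathbb{S}_A=\{J\in A: t(J)=0,\ n(J)=1\}$. Let $Q_{\mathbb{DH}}=\{\alpha+\beta J:\alpha,\beta\in\mathbb{R},\ J\in\mathbb{S}_{\mathbb{DH}}\}$. For $x=\alpha+\beta J\in Q_{\mathbb{DH}}$ put $\mathbb{S}_x=\alpha+\beta\,\mathbb{S}_{\mathbb{DH}}$. Let $D\subseteq\mathbb{C}$ be invariant under complex conjugation and $\Omega=\Omega_D=\{\alpha+\beta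 J:\alpha,\beta\in\mathbb{R},\ \alpha+i\beta\in D,\ J\in\mathbb{S}_{\mathbb{DH}}\}\subseteq Q_{\mathbb{DH}}$. Let $\mathbb{DH}_{\mathbb{C}}=\mathbb{DH}\otimes_{\mathbb{R}}\mathbb{C}=\{a+\iota b: a,b\in\mathbb{DH}\}$, with $\iota^2=-1$, $\iota$ central, and $(a+\iota b)^c=a^c+\iota b^c$. A stem function is $F=F_1+\iota F_2:D\to\mathbb{DH}_{\mathbb{C}}$ with $F_1(\bar z)=F_1(z)$, $F_2(\bar z)=-F_2(z)$; it induces the slice function $f=\mathcal{I}(F):\Omega\to\mathbb{DH}$, $f(\alpha+\beta J)=F_1(\alpha+i\beta)+JF_2(\alpha+i\beta)$. $\mathcal{S}(\Omega)$ is the set of slice functions on $\Omega$. For $f=\mathcal{I}(F)$ and $g=\mathcal{I}(G)$, put $f\cdot g=\mathcal{I}(FG)$ (pointwise product of stem functions), $f^c=\mathcal{I}(F^c)$ with $F^c(z)=F(z)^c$, and $N(f)=f\cdot f^c$ (the normal function of $f$). The primal part of $f=\mathcal{I}(F_1+\iota F_2)$ is the quaternionic slice function ${}^{\pi}\!f:\Omega\cap\mathbb{H}\to\mathbb{H}$, ${}^{\pi}\!f(\alpha+\beta I)=\pi(F_1(\alpha+i\beta))+I\,\pi(F_2(\alpha+i\beta))$ for $I\in\mathbb{S}_{\mathbb{H}}$. $V(\cdot)$ denotes the zero set of a function in its domain. *)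

theory Defs
  imports Complex_Main "HOL-Library.FuncSet"
begin

class conj_algebra = real_algebra_1 +
  fixes conjg :: "'a \<Rightarrow> 'a"
  assumes conjg_conjg [simp]: "conjg (conjg x) = x"
    and conjg_add: "conjg (x + y) = conjg x + conjg y"
    and conjg_mult: "conjg (x * y) = conjg y * conjg x"
    and conjg_scaleR: "conjg (r *\<^sub>R x) = r *\<^sub>R conjg x"

lemma conjg_minus: "conjg (- x) = - conjg (x::'a::conj_algebra)"
  using conjg_scaleR[of "-1" x] by simp

lemma conjg_diff: "conjg (x - y) = conjg x - conjg (y::'a::conj_algebra)"
  using conjg_add[of x "-y"] by (simp add: conjg_minus)

definition trc :: "'a::conj_algebra \<Rightarrow> 'a" where
  "trc h = h + conjg h"

definition nrm :: "'a::conj_algebra \<Rightarrow> 'a" where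
  "nrm h = h * conjg h"

definition imag_units :: "'a::conj_algebra set" where
  "imag_units = {J. trc J = 0 \<and> nrm J = 1}"

lemma conjg_one [simp]: "conjg 1 = (1::'a::conj_algebra)"
  by (metis conjg_conjg conjg_mult mult.right_neutral mult_1)

lemma imag_unitsD:
  assumes "J \<in> imag_units"
  shows "conjg J = - J" and "J * J = - 1"
proof -
  show *: "conjg J = - J"
    using assms by (simp add: imag_units_def trc_def add_eq_0_iff)
  have "J * (- J) = 1"
    using assms by (simp add: imag_units_def nrm_def flip: *)
  then show "J * J = - 1"
    by (metis minus_minus mult_minus_right)
qed

lemma imag_units_minus: "- J \<in> imag_units" if "J \<in> imag_units"
  using imag_unitsD[OF that] by (simp add: imag_units_def trc_def nrm_def conjg_minus)

lemma imag_rep_unique: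
  fixes J J' :: "'a::conj_algebra"
  assumes J: "J \<in> imag_units" "J' \<in> imag_units"
    and eq: "of_real a + b *\<^sub>R J = of_real a' + b' *\<^sub>R J'"
  shows "a' = a \<and> (b = 0 \<and> b' = 0 \<or> b' = b \<and> J' = J \<or> b' = - b \<and> J' = - J)"
proof -
  have "conjg (of_real a + b *\<^sub>R J) = of_real a - b *\<^sub>R J"
       "conjg (of_real a' + b' *\<^sub>R J') = of_real a' - b' *\<^sub>R J'"
    by (simp_all add: of_real_def conjg_add conjg_scaleR J imag_unitsD)
  with eq have "of_real a - b *\<^sub>R J = of_real a' - b' *\<^sub>R J'"
    by metis
  with eq have "(of_real a + b *\<^sub>R J) + (of_real a - b *\<^sub>R J) =
      (of_real a' + b' *\<^sub>R J') + (of_real a' - b' *\<^sub>R J')"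
    by metis
  then have "of_real (a + a) = (of_real (a' + a') :: 'a)"
    by (simp only: of_real_add) simp
  then have a: "a' = a"
    by (simp only: of_real_eq_iff)
  with eq have b: "b *\<^sub>R J = b' *\<^sub>R J'"
    by simp
  then have "(b *\<^sub>R J) * (b *\<^sub>R J) = (b' *\<^sub>R J') * (b' *\<^sub>R J')"
    by simp
  then have "of_real (b * b) = (of_real (b' * b') :: 'a)"
    by (simp add: J imag_unitsD of_real_def del: scaleR_cancel_right)
  then have "b * b = b' * b'"
    by (simp only: of_real_eq_iff)
  then have "b' = b \<or> b' = - b"
    by (metis square_eq_iff)
  then show ?thesis
    using a b by (metis equation_minus_iff neg_equal_0_iff_equal scaleR_cancel_left
      scaleR_minus_left scaleR_minus_right)
qed

text \<open>The quaternions \<open>a + b i + c j + d k\<close>.\<close>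

datatype quat = Quat (qre: real) (qi: real) (qj: real) (qk: real)

instantiation quat :: conj_algebra
begin

definition "0 = Quat 0 0 0 0"
definition "1 = Quat 1 0 0 0"
definition "p + q = Quat (qre p + qre q) (qi p + qi q) (qj p + qj q) (qk p + qk q)"
definition "p - q = Quat (qre p - qre q) (qi p - qi q) (qj p - qj q) (qk p - qk q)"
definition "- q = Quat (- qre q) (- qi q) (- qj q) (- qk q)"
definition "r *\<^sub>R q = Quat (r * qre q) (r * qi q) (r * qj q) (r * qk q)"
definition "p * q = Quat
  (qre p * qre q - qi p * qi q - qj p * qj q - qk p * qk q)
  (qre p * qi q + qi p * qre q + qj p * qk q - qk p * qj q)
  (qre p * qj q - qi p * qk q + qj p * qre q + qk p * qi q)
  (qre p * qk q + qi p * qj q - qj p * qi q + qk p * qre q)"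
definition "conjg q = Quat (qre q) (- qi q) (- qj q) (- qk q)"

lemmas quat_defs = zero_quat_def one_quat_def plus_quat_def minus_quat_def uminus_quat_def
  scaleR_quat_def times_quat_def conjg_quat_def

instance
  by standard (auto simp: quat_defs quat.expand algebra_simps)

end

text \<open>The dual algebra \<open>A + \<epsilon> A\<close> over an algebra \<open>A\<close>, with \<open>\<epsilon>\<close> central and \<open>\<epsilon>\<^sup>2 = 0\<close>.\<close>

datatype 'a dual = Dual (primal: 'a) (dualpart: 'a)

instantiation dual :: (conj_algebra) conj_algebra
begin

definition "0 = Dual 0 0"
definition "1 = Dual 1 0"
definition "h + h' = Dual (primal h + primal h') (dualpart h + dualpart h')"
definition "h - h' = Dual (primal h - primal h') (dualpart h - dualpart h')"
definition "- h = Dual (- primal h) (- dualpart h)"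
definition "r *\<^sub>R h = Dual (r *\<^sub>R primal h) (r *\<^sub>R dualpart h)"
definition "h * h' = Dual (primal h * primal h') (primal h * dualpart h' + dualpart h * primal h')"
definition "conjg h = Dual (conjg (primal h)) (conjg (dualpart h))"

lemmas dual_defs = zero_dual_def one_dual_def plus_dual_def minus_dual_def uminus_dual_def
  scaleR_dual_def times_dual_def conjg_dual_def

instance
  by standard (auto simp: dual_defs dual.expand algebra_simps conjg_add conjg_mult conjg_scaleR)

end

text \<open>The complexification \<open>A + \<iota> A\<close>, with \<open>\<iota>\<close> central and \<open>\<iota>\<^sup>2 = -1\<close>. The conjugation is
  the one coming from \<open>A\<close>; it fixes \<open>\<iota>\<close>.\<close>

datatype 'a cplx = Cplx (part1: 'a) (part2: 'a)

instantiation cplx :: (conj_algebra) conj_algebra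
begin

definition "0 = Cplx 0 0"
definition "1 = Cplx 1 0"
definition "u + v = Cplx (part1 u + part1 v) (part2 u + part2 v)"
definition "u - v = Cplx (part1 u - part1 v) (part2 u - part2 v)"
definition "- u = Cplx (- part1 u) (- part2 u)"
definition "r *\<^sub>R u = Cplx (r *\<^sub>R part1 u) (r *\<^sub>R part2 u)"
definition "u * v = Cplx (part1 u * part1 v - part2 u * part2 v) (part1 u * part2 v + part2 u * part1 v)"
definition "conjg u = Cplx (conjg (part1 u)) (conjg (part2 u))"

lemmas cplx_defs = zero_cplx_def one_cplx_def plus_cplx_def minus_cplx_def uminus_cplx_def
  scaleR_cplx_def times_cplx_def conjg_cplx_def

instance
  by standard (auto simp: cplx_defs cplx.expand algebra_simps conjg_add conjg_diff conjg_mult conjg_scaleR)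

end

type_synonym dquat = "quat dual"

text \<open>The quaternions as a subset of the dual quaternions.\<close>

definition quats :: "dquat set" where
  "quats = range (\<lambda>q. Dual q 0)"

definition circ :: "complex set \<Rightarrow> dquat set" where
  "circ D = {of_real \<alpha> + \<beta> *\<^sub>R J | \<alpha> \<beta> J. Complex \<alpha> \<beta> \<in> D \<and> J \<in> imag_units}"

text \<open>\<open>sph x = \<alpha> + \<beta> imag_units\<close> for any representation \<open>x = \<alpha> + \<beta> J\<close>; see \<open>sph_eq\<close> below
  for independence of the representation.\<close>

definition sph :: "dquat \<Rightarrow> dquat set" where
  "sph x = {of_real \<alpha> + \<beta> *\<^sub>R K | \<alpha> \<beta> J K.
     J \<in> imag_units \<and> K \<in> imag_units \<and> x = of_real \<alpha> + \<beta> *\<^sub>R J}"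

lemma sph_eq:
  assumes J: "J \<in> imag_units"
  shows "sph (of_real \<alpha> + \<beta> *\<^sub>R J) = {of_real \<alpha> + \<beta> *\<^sub>R K | K. K \<in> imag_units}"
proof (intro equalityI subsetI)
  fix y assume "y \<in> sph (of_real \<alpha> + \<beta> *\<^sub>R J)"
  then obtain a b J' K where y: "y = of_real a + b *\<^sub>R K" "J' \<in> imag_units" "K \<in> imag_units"
    "of_real \<alpha> + \<beta> *\<^sub>R J = of_real a + b *\<^sub>R J'"
    unfolding sph_def by blast
  have "a = \<alpha> \<and> (b = \<beta> \<or> b = - \<beta>)"
    using imag_rep_unique[OF J y(2,4)] by auto
  then have "y = of_real \<alpha> + \<beta> *\<^sub>R K \<or> y = of_real \<alpha> + \<beta> *\<^sub>R (- K)"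
    using y by auto
  then show "y \<in> {of_real \<alpha> + \<beta> *\<^sub>R K | K. K \<in> imag_units}"
    using y imag_units_minus by blast
qed (use J in \<open>unfold sph_def, blast\<close>)

text \<open>Functions on a set are represented extensionally (value \<open>undefined\<close> outside the set), so
  that stem functions on \<open>D\<close> correspond bijectively to slice functions on \<open>circ D\<close>.\<close>

definition stem_functions :: "complex set \<Rightarrow> (complex \<Rightarrow> dquat cplx) set" where
  "stem_functions D = {F \<in> extensional D. \<forall>z\<in>D.
     part1 (F (cnj z)) = part1 (F z) \<and> part2 (F (cnj z)) = - part2 (F z)}"

definition slice_of :: "complex set \<Rightarrow> (complex \<Rightarrow> dquat cplx) \<Rightarrow> dquat \<Rightarrow> dquat" where
  "slice_of D F = (\<lambda>x\<in>circ D. THE y. \<exists>\<alpha> \<beta> J. Complex \<alpha> \<beta> \<in> D \<and> J \<in> imag_units \<and>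
     x = of_real \<alpha> + \<beta> *\<^sub>R J \<and>
     y = part1 (F (Complex \<alpha> \<beta>)) + J * part2 (F (Complex \<alpha> \<beta>)))"

definition slice_functions :: "complex set \<Rightarrow> (dquat \<Rightarrow> dquat) set" where
  "slice_functions D = slice_of D ` stem_functions D"

definition stem_of :: "complex set \<Rightarrow> (dquat \<Rightarrow> dquat) \<Rightarrow> complex \<Rightarrow> dquat cplx" where
  "stem_of D = the_inv_into (stem_functions D) (slice_of D)"

lemma slice_of_eq:
  assumes F: "F \<in> stem_functions D" and D: "Complex \<alpha> \<beta> \<in> D" and J: "J \<in> imag_units"
  shows "slice_of D F (of_real \<alpha> + \<beta> *\<^sub>R J) =
    part1 (F (Complex \<alpha> \<beta>)) + J * part2 (F (Complex \<alpha> \<beta>))"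
proof -
  let ?x = "of_real \<alpha> + \<beta> *\<^sub>R J"
  have x: "?x \<in> circ D"
    using D J unfolding circ_def by blast
  have sym: "part1 (F (Complex \<alpha> (- \<beta>))) = part1 (F (Complex \<alpha> \<beta>))"
            "part2 (F (Complex \<alpha> (- \<beta>))) = - part2 (F (Complex \<alpha> \<beta>))"
    using F D unfolding stem_functions_def by (fastforce simp: complex_cnj)+
  have zero: "part2 (F (Complex \<alpha> \<beta>)) = 0" if "\<beta> = 0"
  proof -
    have "2 *\<^sub>R part2 (F (Complex \<alpha> \<beta>)) = 0"
      using sym(2) that by (metis add.right_inverse minus_zero scaleR_2)
    then show ?thesis
      by simp
  qed
  have "y = part1 (F (Complex \<alpha> \<beta>)) + J * part2 (F (Complex \<alpha> \<beta>))"
    if K: "K \<in> imag_units" "?x = of_real a + b *\<^sub>R K"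
      and y: "y = part1 (F (Complex a b)) + K * part2 (F (Complex a b))" for a b K y
    using imag_rep_unique[OF J K] y sym zero by auto
  then show ?thesis
    unfolding slice_of_def restrict_apply'[OF x]
    by (intro the_equality) (use D J in blast)+
qed

lemma imag_unit_exists: "Dual (Quat 0 1 0 0) 0 \<in> imag_units"
  by (simp add: imag_units_def trc_def nrm_def dual_defs quat_defs)

lemma inj_on_slice_of: "inj_on (slice_of D) (stem_functions D)"
proof (rule inj_onI)
  fix F G assume F: "F \<in> stem_functions D" and G: "G \<in> stem_functions D"
    and eq: "slice_of D F = slice_of D G"
  define J :: dquat where "J = Dual (Quat 0 1 0 0) 0"
  have J: "J \<in> imag_units"
    unfolding J_def by (rule imag_unit_exists)
  show "F = G"
  proof (rule extensionalityI)
    show "F \<in> extensional D" "G \<in> extensional D"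
      using F G by (auto simp: stem_functions_def)
    fix z assume "z \<in> D"
    then have z: "Complex (Re z) (Im z) \<in> D"
      by simp
    let ?p = "part1 (F z) - part1 (G z)" and ?q = "part2 (F z) - part2 (G z)"
    have "part1 (F z) + J * part2 (F z) = part1 (G z) + J * part2 (G z)"
      using slice_of_eq[OF F z J] slice_of_eq[OF G z J] eq by simp
    then have 1: "?p + J * ?q = 0"
      by (simp add: algebra_simps)
    have "part1 (F z) + (- J) * part2 (F z) = part1 (G z) + (- J) * part2 (G z)"
      using slice_of_eq[OF F z imag_units_minus[OF J]] slice_of_eq[OF G z imag_units_minus[OF J]] eq
      by simp
    then have 2: "?p - J * ?q = 0"
      by (simp add: algebra_simps)
    have "2 *\<^sub>R ?p = (?p + J * ?q) + (?p - J * ?q)"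
      by (simp only: scaleR_2) simp
    then have p: "?p = 0"
      unfolding 1 2 by simp
    then have "J * ?q = 0"
      using 1 by simp
    then have "(J * J) * ?q = 0"
      by (simp only: mult.assoc mult_zero_right)
    then have "?q = 0"
      by (simp add: imag_unitsD(2)[OF J])
    with p show "F z = G z"
      by (simp add: cplx.expand)
  qed
qed

lemma stem_of_slice_of: "F \<in> stem_functions D \<Longrightarrow> stem_of D (slice_of D F) = F"
  unfolding stem_of_def by (rule the_inv_into_f_f[OF inj_on_slice_of])

definition slice_mult ::
    "complex set \<Rightarrow> (dquat \<Rightarrow> dquat) \<Rightarrow> (dquat \<Rightarrow> dquat) \<Rightarrow> dquat \<Rightarrow> dquat" where
  "slice_mult D f g = slice_of D (\<lambda>z\<in>D. stem_of D f z * stem_of D g z)"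

definition slice_conj :: "complex set \<Rightarrow> (dquat \<Rightarrow> dquat) \<Rightarrow> dquat \<Rightarrow> dquat" where
  "slice_conj D f = slice_of D (\<lambda>z\<in>D. conjg (stem_of D f z))"

definition normal_fun :: "complex set \<Rightarrow> (dquat \<Rightarrow> dquat) \<Rightarrow> dquat \<Rightarrow> dquat" where
  "normal_fun D f = slice_mult D f (slice_conj D f)"

definition primal_fun :: "complex set \<Rightarrow> (dquat \<Rightarrow> dquat) \<Rightarrow> dquat \<Rightarrow> quat" where
  "primal_fun D f = (\<lambda>x\<in>circ D \<inter> quats. THE y. \<exists>\<alpha> \<beta> I. Complex \<alpha> \<beta> \<in> D \<and> I \<in> imag_units \<and>
     x = Dual (of_real \<alpha> + \<beta> *\<^sub>R I) 0 \<and>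
     y = primal (part1 (stem_of D f (Complex \<alpha> \<beta>)))
       + I * primal (part2 (stem_of D f (Complex \<alpha> \<beta>))))"

lemma primal_fun_slice_of_eq:
  assumes F: "F \<in> stem_functions D" and D: "Complex \<alpha> \<beta> \<in> D" and I: "I \<in> imag_units"
  shows "primal_fun D (slice_of D F) (Dual (of_real \<alpha> + \<beta> *\<^sub>R I) 0) =
    primal (part1 (F (Complex \<alpha> \<beta>))) + I * primal (part2 (F (Complex \<alpha> \<beta>)))"
proof -
  let ?x = "Dual (of_real \<alpha> + \<beta> *\<^sub>R I) 0"
  have "Dual I 0 \<in> imag_units"
    using I by (simp add: imag_units_def trc_def nrm_def dual_defs conjg_scaleR[of 0, simplified])
  moreover have "?x = of_real \<alpha> + \<beta> *\<^sub>R Dual I 0"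
    by (simp add: of_real_def dual_defs)
  ultimately have x: "?x \<in> circ D \<inter> quats"
    using D unfolding circ_def quats_def by blast
  have sym: "part1 (F (Complex \<alpha> (- \<beta>))) = part1 (F (Complex \<alpha> \<beta>))"
            "part2 (F (Complex \<alpha> (- \<beta>))) = - part2 (F (Complex \<alpha> \<beta>))"
    using F D unfolding stem_functions_def by (fastforce simp: complex_cnj)+
  have zero: "part2 (F (Complex \<alpha> \<beta>)) = 0" if "\<beta> = 0"
  proof -
    have "2 *\<^sub>R part2 (F (Complex \<alpha> \<beta>)) = 0"
      using sym(2) that by (metis add.right_inverse minus_zero scaleR_2)
    then show ?thesis
      by simp
  qed
  have "y = primal (part1 (F (Complex \<alpha> \<beta>))) + I * primal (part2 (F (Complex \<alpha> \<beta>)))"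
    if K: "K \<in> imag_units" "?x = Dual (of_real a + b *\<^sub>R K) 0"
      and y: "y = primal (part1 (F (Complex a b))) + K * primal (part2 (F (Complex a b)))" for a b K y
  proof -
    have "of_real \<alpha> + \<beta> *\<^sub>R I = of_real a + b *\<^sub>R K"
      using K(2) by simp
    from imag_rep_unique[OF I K(1) this] show ?thesis
      using y sym zero by (auto simp: zero_dual_def uminus_dual_def)
  qed
  then show ?thesis
    unfolding primal_fun_def restrict_apply'[OF x] stem_of_slice_of[OF F]
    by (intro the_equality) (use D I in blast)+
qed

definition zeros :: "'a set \<Rightarrow> ('a \<Rightarrow> 'b::zero) \<Rightarrow> 'a set" where
  "zeros A f = {x \<in> A. f x = 0}"

end

(* Write F(z) = a + \<iota>b at z = \<alpha> + i\<beta>. Then N(f)(\<alpha> + \<beta>J) = P + JQ with P = n(a) - n(b) and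
   Q = t(ab\<^sup>c), which are dual numbers, hence central and fixed by conjugation. Adding and subtracting
   the conjugate equation shows that N(f) vanishes at one point of a sphere iff P = Q = 0, i.e. iff
   it vanishes on the whole sphere. If b has nonzero primal part, it is invertible and
   P = Q = 0 says precisely that -ab\<^sup>-\<^sup>1 is an imaginary unit, which gives the only zero of f on the sphere.
   If b has zero primal part, then P = 0 forces a to have zero primal part too. *)
theory Submission imports Defs begin

section \<open>Conjugation, trace and norm\<close>

lemma conjg_zero [simp]: "conjg 0 = (0::'a::conj_algebra)"
  using conjg_scaleR[of 0 "0::'a"] by simp

lemma conjg_trc: "conjg (trc h) = trc (h::'a::conj_algebra)"
  by (simp add: trc_def conjg_add add.commute)

lemma conjg_nrm: "conjg (nrm h) = nrm (h::'a::conj_algebra)"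
  by (simp add: nrm_def conjg_mult)

text \<open>Both components of h + h^c are real, so a trace is a dual number and commutes with
  everything.\<close>

lemma trc_dquat_commute: "trc (h::dquat) * x = x * trc h"
  by (simp add: trc_def dual_defs quat_defs algebra_simps)

lemma nrm_dquat_commute: "nrm (h::dquat) * x = x * nrm h"
  by (simp add: nrm_def dual_defs quat_defs algebra_simps)

lemma nrm_dquat_conjg: "conjg h * h = nrm (h::dquat)"
  by (simp add: nrm_def dual_defs quat_defs algebra_simps)

text \<open>Since J^c = -J and Q commutes with J, conjugation turns P + JQ into P - JQ. Adding the
  two equations gives 2P = 0; multiplying JQ = 0 by J then gives Q = 0.\<close>

lemma add_imag_unit_mult_eq_0_iff:
  fixes P Q J :: "'a::conj_algebra"
  assumes "conjg P = P" "conjg Q = Q" "Q * J = J * Q" and J: "J \<in> imag_units"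
  shows "P + J * Q = 0 \<longleftrightarrow> P = 0 \<and> Q = 0"
proof
  assume 1: "P + J * Q = 0"
  have "conjg (P + J * Q) = P - J * Q"
    using assms by (simp add: conjg_add conjg_mult imag_unitsD)
  then have "P - J * Q = 0"
    using 1 by simp
  then have "2 *\<^sub>R P = 0"
    using 1 by (metis add_cancel_left_right diff_add_cancel eq_iff_diff_eq_0 scaleR_2)
  then have P: "P = 0"
    by simp
  then have "(J * J) * Q = 0"
    using 1 by (simp only: mult.assoc) simp
  then show "P = 0 \<and> Q = 0"
    using P by (simp add: imag_unitsD(2)[OF J])
qed simp

section \<open>Anisotropy of the quaternion norm, and primal parts\<close>

lemma nrm_quat_eq: "nrm (q::quat) = of_real ((qre q)\<^sup>2 + (qi q)\<^sup>2 + (qj q)\<^sup>2 + (qk q)\<^sup>2)"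
  by (simp add: nrm_def of_real_def quat_defs power2_eq_square algebra_simps)

text \<open>The norm is a sum of four real squares. Dual quaternions of the form \<epsilon>q all
  have norm zero, so there the argument applies to primal parts only.\<close>

lemma nrm_quat_eq_0_iff: "nrm (q::quat) = 0 \<longleftrightarrow> q = 0"
proof
  assume "nrm q = 0"
  then have "(qre q)\<^sup>2 + (qi q)\<^sup>2 + (qj q)\<^sup>2 + (qk q)\<^sup>2 = 0"
    by (simp only: nrm_quat_eq of_real_eq_0_iff)
  then have "qre q = 0 \<and> qi q = 0 \<and> qj q = 0 \<and> qk q = 0"
    by (simp add: add_nonneg_eq_0_iff)
  then show "q = 0"
    by (simp add: zero_quat_def quat.expand)
qed (simp add: nrm_def)

lemma primal_nrm: "primal (nrm h) = nrm (primal h)"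
  by (simp add: nrm_def dual_defs)

lemma primal_add [simp]: "primal (x + y) = primal x + primal y"
  by (simp add: dual_defs)

lemma primal_mult [simp]: "primal (x * y) = primal x * primal y"
  by (simp add: dual_defs)

lemma primal_zero [simp]: "primal 0 = 0"
  by (simp add: dual_defs)

lemma primal_conjg [simp]: "primal (conjg x) = conjg (primal x)"
  by (simp add: dual_defs)

text \<open>Both factors are multiples of \<epsilon>, and \<epsilon>^2 = 0. This makes n(a), n(b)
  and ab^c vanish in the degenerate case where a and b have zero primal part.\<close>

lemma dual_mult_eq_0:
  assumes "primal x = 0" "primal y = 0"
  shows "x * y = 0"
  using assms by (simp add: dual_defs)

section \<open>Inverse norms and the equation a + Jb = 0\<close>

lemma nrm_dquat_inverse:
  fixes b :: dquat
  assumes "primal b \<noteq> 0"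
  obtains c where "c * nrm b = 1" "conjg c = c" "\<And>h. c * h = h * c"
proof -
  obtain r where r: "nrm (primal b) = of_real r"
    using nrm_quat_eq by blast
  have "r \<noteq> 0"
    using assms nrm_quat_eq_0_iff[of "primal b"] r by auto
  obtain s where s: "dualpart (nrm b) = of_real s"
  proof
    \<comment> \<open>With primal part p and dual part d of b, this is pd^c + dp^c, twice the
      Euclidean inner product of p and d.\<close>
    show "dualpart (nrm b) = of_real (2 * (qre (primal b) * qre (dualpart b)
        + qi (primal b) * qi (dualpart b) + qj (primal b) * qj (dualpart b)
        + qk (primal b) * qk (dualpart b)))"
      by (simp add: nrm_def of_real_def dual_defs quat_defs algebra_simps)
  qed
  have nb: "nrm b = Dual (of_real r) (of_real s)"
    using r s by (simp add: dual.expand primal_nrm)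
  show thesis
  proof
    \<comment> \<open>Since \<epsilon>^2 = 0, the dual number r + \<epsilon>s has inverse 1/r -
      \<epsilon>s/r^2.\<close>
    let ?c = "Dual (of_real (1 / r)) (of_real (- s / r\<^sup>2)) :: dquat"
    show "?c * nrm b = 1"
      using \<open>r \<noteq> 0\<close> by (simp add: nb dual_defs quat_defs of_real_def field_simps power2_eq_square)
    show "conjg ?c = ?c" "?c * h = h * ?c" for h
      by (simp_all add: dual_defs quat_defs of_real_def)
  qed
qed

lemma imag_root_if_nrm_eq:
  fixes a b :: dquat
  assumes b: "primal b \<noteq> 0" and "nrm a = nrm b" and "trc (a * conjg b) = 0"
  shows "\<exists>J\<in>imag_units. a + J * b = 0"
proof -
  obtain c where c: "c * nrm b = 1" "conjg c = c" "\<And>h. c * h = h * c"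
    using nrm_dquat_inverse[OF b] by blast
  \<comment> \<open>As \<open>c\<close> is the inverse of n(b), this is -ab^-1 with b^-1 = b^c c.
    Its trace is -c t(ab^c) and its norm is c^2 n(a) n(b).\<close>
  let ?J = "- (c * (a * conjg b))"
  have "trc ?J = - (c * trc (a * conjg b))"
    by (simp add: trc_def conjg_minus conjg_mult c distrib_left mult.assoc)
  moreover have "nrm ?J = 1"
  proof -
    have "nrm ?J = c * (a * (conjg b * b) * conjg a) * c"
      by (simp add: nrm_def conjg_minus conjg_mult c(2) mult.assoc)
    also have "\<dots> = c * (nrm b * (a * conjg a)) * c"
      by (simp only: nrm_dquat_conjg nrm_dquat_commute mult.assoc)
    also have "\<dots> = (c * nrm b) * (c * nrm a)"
      by (metis c(3) mult.assoc nrm_def)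
    finally show ?thesis
      using c(1) assms(2) by simp
  qed
  moreover have "a + ?J * b = 0"
  proof -
    have "?J * b = - (c * (a * (conjg b * b)))"
      by (simp add: mult.assoc)
    also have "\<dots> = - (c * nrm b * a)"
      by (simp only: nrm_dquat_conjg nrm_dquat_commute mult.assoc)
    finally show ?thesis
      using c(1) by simp
  qed
  ultimately show ?thesis
    using assms(3) unfolding imag_units_def by (intro bexI[of _ ?J]) auto
qed

text \<open>Substitute a = -Jb. As n(b) is central, n(a) = n(b) n(J), and ab^c = -n(b) J has trace
  -n(b) t(J) = 0.\<close>

lemma nrm_eq_if_imag_root:
  fixes a b :: dquat
  assumes J: "J \<in> imag_units" and "a + J * b = 0"
  shows "nrm a = nrm b" and "trc (a * conjg b) = 0"
proof -
  have a: "a = - (J * b)"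
    using assms(2) by (simp add: eq_neg_iff_add_eq_0)
  have "nrm a = J * nrm b * conjg J"
    by (simp add: a nrm_def conjg_minus conjg_mult mult.assoc)
  also have "\<dots> = nrm b * nrm J"
    by (simp only: nrm_def[of J] nrm_dquat_commute[symmetric] mult.assoc)
  finally show "nrm a = nrm b"
    using J by (simp add: imag_units_def)
  have "trc (a * conjg b) = - (J * nrm b) - nrm b * conjg J"
    by (simp add: a trc_def nrm_def conjg_minus conjg_mult mult.assoc)
  also have "\<dots> = 0"
    by (simp add: imag_unitsD[OF J] nrm_dquat_commute)
  finally show "trc (a * conjg b) = 0" .
qed

lemma nrm_eq_trc_eq_0_iff:
  fixes a b :: dquat
  shows "nrm a = nrm b \<and> trc (a * conjg b) = 0 \<longleftrightarrow>
    (\<exists>J\<in>imag_units. a + J * b = 0) \<or> (primal a = 0 \<and> primal b = 0)"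
proof -
  have "nrm a = nrm b \<and> trc (a * conjg b) = 0" if "primal a = 0" "primal b = 0"
    using that by (simp add: nrm_def trc_def dual_mult_eq_0)
  \<comment> \<open>The primal part of n(a) = n(b) says that \<open>primal a\<close> has norm zero.
    So \<open>primal b = 0\<close> leads to the degenerate alternative, and otherwise b is
    invertible.\<close>
  moreover have "primal a = 0" if "nrm a = nrm b" "primal b = 0"
    using that by (metis nrm_quat_eq_0_iff primal_nrm)
  ultimately show ?thesis
    using imag_root_if_nrm_eq nrm_eq_if_imag_root by blast
qed

text \<open>A right inverse of b is b^c n(b)^-1.\<close>

lemma dquat_mult_right_cancel:
  fixes b J K :: dquat
  assumes b: "primal b \<noteq> 0" and eq: "J * b = K * b"
  shows "J = K"
proof -
  obtain c where c: "c * nrm b = 1" "\<And>h. c * h = h * c"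
    using nrm_dquat_inverse[OF b] by blast
  have "h * b * conjg b * c = h" for h
    using c by (metis mult.assoc mult.right_neutral nrm_def)
  then show ?thesis
    using eq by metis
qed

text \<open>If \<open>primal b\<close> were zero, the primal part of the equation would make
  \<open>primal a\<close> zero too. Hence b can be cancelled.\<close>

lemma imag_root_unique:
  fixes a b J K :: dquat
  assumes "\<not> (primal a = 0 \<and> primal b = 0)" "a + J * b = 0" "a + K * b = 0"
  shows "J = K"
proof (rule dquat_mult_right_cancel)
  show "J * b = K * b"
    using assms(2,3) by (metis add_left_cancel)
  have "primal a + primal J * primal b = 0"
    using assms(2) by (metis primal_add primal_mult primal_zero)
  then show "primal b \<noteq> 0"
    using assms(1) by auto
qed

section \<open>The stem of the normal function\<close>

lemma stem_functions_mult:
  assumes "cnj ` D = D" "F \<in> stem_functions D" "G \<in> stem_functions D"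
  shows "(\<lambda>z\<in>D. F z * G z) \<in> stem_functions D"
proof -
  \<comment> \<open>The symmetry conditions evaluate the restricted function at the conjugate point,
    where it must not take the default value \<open>undefined\<close>.\<close>
  have "cnj z \<in> D" if "z \<in> D" for z
    using assms(1) that by blast
  then show ?thesis
    using assms(2,3) by (auto simp: stem_functions_def cplx_defs)
qed

lemma stem_functions_conjg:
  assumes "cnj ` D = D" "F \<in> stem_functions D"
  shows "(\<lambda>z\<in>D. conjg (F z)) \<in> stem_functions D"
proof -
  have "cnj z \<in> D" if "z \<in> D" for z
    using assms(1) that by blast
  then show ?thesis
    using assms(2) by (auto simp: stem_functions_def cplx_defs conjg_minus)
qed

text \<open>Expand (a + \<iota>b)(a^c + \<iota>b^c). The coefficient of \<iota> is ab^c + ba^c, a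
  trace because ba^c = (ab^c)^c.\<close>

lemma normal_fun_slice_of_eq:
  assumes D: "cnj ` D = D" and F: "F \<in> stem_functions D"
    and z: "Complex \<alpha> \<beta> \<in> D" and J: "J \<in> imag_units"
  defines "a \<equiv> part1 (F (Complex \<alpha> \<beta>))" and "b \<equiv> part2 (F (Complex \<alpha> \<beta>))"
  shows "normal_fun D (slice_of D F) (of_real \<alpha> + \<beta> *\<^sub>R J) =
    (nrm a - nrm b) + J * trc (a * conjg b)"
proof -
  note Fc = stem_functions_conjg[OF D F]
  have "normal_fun D (slice_of D F) = slice_of D (\<lambda>z\<in>D. F z * (\<lambda>z\<in>D. conjg (F z)) z)"
    by (simp add: normal_fun_def slice_mult_def slice_conj_def stem_of_slice_of F Fc)
  then show ?thesis
    using z slice_of_eq[OF stem_functions_mult[OF D F Fc] z J]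
    by (simp add: a_def b_def cplx_defs nrm_def trc_def conjg_mult)
qed

text \<open>The right-hand side does not mention J, so a zero at one point of a sphere spreads to
  the whole sphere.\<close>

lemma normal_fun_eq_0_iff:
  assumes D: "cnj ` D = D" and F: "F \<in> stem_functions D"
    and z: "Complex \<alpha> \<beta> \<in> D" and J: "J \<in> imag_units"
  defines "a \<equiv> part1 (F (Complex \<alpha> \<beta>))" and "b \<equiv> part2 (F (Complex \<alpha> \<beta>))"
  shows "normal_fun D (slice_of D F) (of_real \<alpha> + \<beta> *\<^sub>R J) = 0 \<longleftrightarrow>
    (\<exists>K\<in>imag_units. a + K * b = 0) \<or> (primal a = 0 \<and> primal b = 0)"
proof -
  have "normal_fun D (slice_of D F) (of_real \<alpha> + \<beta> *\<^sub>R J) = 0 \<longleftrightarrow>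
      nrm a - nrm b = 0 \<and> trc (a * conjg b) = 0"
    unfolding normal_fun_slice_of_eq[OF D F z J, folded a_def b_def]
    by (intro add_imag_unit_mult_eq_0_iff J)
      (simp_all add: conjg_diff conjg_nrm conjg_trc trc_dquat_commute)
  then show ?thesis
    using nrm_eq_trc_eq_0_iff[of a b] by simp
qed

section \<open>Quaternionic points of a sphere\<close>

lemma Dual_imag_units:
  assumes "I \<in> imag_units"
  shows "Dual I 0 \<in> imag_units"
  using assms by (simp add: imag_units_def trc_def nrm_def dual_defs)

lemma primal_imag_units:
  assumes "J \<in> imag_units"
  shows "primal J \<in> imag_units"
  using assms by (simp add: imag_units_def trc_def nrm_def dual_defs)

lemma Dual_of_real_add_scaleR:
  "Dual (of_real \<alpha> + \<beta> *\<^sub>R I) 0 = of_real \<alpha> + \<beta> *\<^sub>R Dual I 0"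
  by (simp add: of_real_def dual_defs)

lemma sph_Int_quats:
  assumes J: "J \<in> imag_units"
  shows "sph (of_real \<alpha> + \<beta> *\<^sub>R J) \<inter> quats =
    {Dual (of_real \<alpha> + \<beta> *\<^sub>R I) 0 | I. I \<in> imag_units}" (is "?L = ?R")
proof
  show "?L \<subseteq> ?R"
  proof
    fix y assume "y \<in> ?L"
    then obtain K where K: "K \<in> imag_units" "y = of_real \<alpha> + \<beta> *\<^sub>R K" and "y \<in> quats"
      using sph_eq[OF J] by blast
    from \<open>y \<in> quats\<close> have "y = Dual (primal y) 0"
      by (auto simp: quats_def)
    \<comment> \<open>For \<beta> = 0 the unit K may have a nonzero dual part even though y is a
      quaternion, so the witness is \<open>primal K\<close>.\<close>
    also have "primal y = of_real \<alpha> + \<beta> *\<^sub>R primal K"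
      by (simp add: K of_real_def dual_defs)
    finally show "y \<in> ?R"
      using primal_imag_units[OF K(1)] by blast
  qed
  show "?R \<subseteq> ?L"
  proof
    fix y assume "y \<in> ?R"
    then obtain I where I: "I \<in> imag_units" "y = Dual (of_real \<alpha> + \<beta> *\<^sub>R I) 0"
      by blast
    then have "y \<in> sph (of_real \<alpha> + \<beta> *\<^sub>R J)"
      unfolding sph_eq[OF J] Dual_of_real_add_scaleR using Dual_imag_units by blast
    then show "y \<in> ?L"
      by (simp add: I quats_def)
  qed
qed

lemma imag_unit_quat: "Quat 0 1 0 0 \<in> imag_units"
  by (simp add: imag_units_def trc_def nrm_def quat_defs)

lemma primal_fun_vanishes_iff:
  assumes F: "F \<in> stem_functions D" and z: "Complex \<alpha> \<beta> \<in> D" and J: "J \<in> imag_units"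
  shows "(\<forall>y \<in> sph (of_real \<alpha> + \<beta> *\<^sub>R J) \<inter> quats. primal_fun D (slice_of D F) y = 0) \<longleftrightarrow>
    primal (part1 (F (Complex \<alpha> \<beta>))) = 0 \<and> primal (part2 (F (Complex \<alpha> \<beta>))) = 0"
    (is "?L \<longleftrightarrow> ?p = 0 \<and> ?q = 0")
proof -
  have "?L \<longleftrightarrow> (\<forall>I\<in>imag_units. ?p + I * ?q = 0)"
    unfolding sph_Int_quats[OF J] using primal_fun_slice_of_eq[OF F z] by force
  also have "\<dots> \<longleftrightarrow> ?p = 0 \<and> ?q = 0"
  proof
    \<comment> \<open>The units i and -i suffice: the sum of their equations isolates
      \<open>?p\<close>, and multiplying by i then isolates \<open>?q\<close>.\<close>
    let ?i = "Quat 0 1 0 0"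
    assume *: "\<forall>I\<in>imag_units. ?p + I * ?q = 0"
    then have 1: "?p + ?i * ?q = 0" and 2: "?p - ?i * ?q = 0"
      using imag_unit_quat imag_units_minus by fastforce+
    then have "2 *\<^sub>R ?p = 0"
      by (metis add_cancel_left_right diff_add_cancel eq_iff_diff_eq_0 scaleR_2)
    then have p: "?p = 0"
      by simp
    then have "(?i * ?i) * ?q = 0"
      using 1 by (simp only: mult.assoc) simp
    then show "?p = 0 \<and> ?q = 0"
      using p by (simp add: imag_unitsD(2)[OF imag_unit_quat])
  qed simp
  finally show ?thesis .
qed

section \<open>Zeros on a whole sphere\<close>

lemma sph_subset_circ: "x \<in> circ D \<Longrightarrow> sph x \<subseteq> circ D"
  unfolding circ_def by (force simp: sph_eq)

lemma mem_sph_self: "x \<in> circ D \<Longrightarrow> x \<in> sph x"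
  unfolding circ_def by (auto simp: sph_eq)

lemma sph_cong: "x \<in> circ D \<Longrightarrow> y \<in> sph x \<Longrightarrow> sph y = sph x"
  unfolding circ_def by (smt (verit, best) mem_Collect_eq sph_eq)

text \<open>Puts the criterion in terms of the set \<open>sph x\<close> alone, so that
  \<open>sph_cong\<close> carries it to every other point of the sphere.\<close>

lemma normal_fun_eq_0_iff_sph:
  assumes D: "cnj ` D = D" and f: "f \<in> slice_functions D" and x: "x \<in> circ D"
  shows "normal_fun D f x = 0 \<longleftrightarrow>
    (\<exists>y\<in>sph x. f y = 0) \<or> (\<forall>y \<in> sph x \<inter> quats. primal_fun D f y = 0)"
proof -
  obtain F where F: "F \<in> stem_functions D" and fF: "f = slice_of D F"
    using f by (auto simp: slice_functions_def)
  obtain \<alpha> \<beta> J where z: "Complex \<alpha> \<beta> \<in> D" and J: "J \<in> imag_units" and xeq: "x = of_real \<alpha> + \<beta> *\<^sub>R J"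
    using x by (auto simp: circ_def)
  have "(\<exists>y\<in>sph x. f y = 0) \<longleftrightarrow>
      (\<exists>K\<in>imag_units. part1 (F (Complex \<alpha> \<beta>)) + K * part2 (F (Complex \<alpha> \<beta>)) = 0)"
    unfolding xeq sph_eq[OF J] fF using slice_of_eq[OF F z] by force
  then show ?thesis
    using normal_fun_eq_0_iff[OF D F z J] primal_fun_vanishes_iff[OF F z J]
    by (simp add: xeq fF)
qed

text \<open>Two zeros on the sphere give two roots K of a + Kb = 0, and outside the degenerate case
  there is at most one.\<close>

lemma zero_unique_on_sph:
  assumes f: "f \<in> slice_functions D" and x: "x \<in> circ D"
    and primal: "\<not> (\<forall>y \<in> sph x \<inter> quats. primal_fun D f y = 0)"
    and y: "y \<in> sph x" "f y = 0" and y': "y' \<in> sph x" "f y' = 0"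
  shows "y = y'"
proof -
  obtain F where F: "F \<in> stem_functions D" and fF: "f = slice_of D F"
    using f by (auto simp: slice_functions_def)
  obtain \<alpha> \<beta> J where z: "Complex \<alpha> \<beta> \<in> D" and J: "J \<in> imag_units" and xeq: "x = of_real \<alpha> + \<beta> *\<^sub>R J"
    using x by (auto simp: circ_def)
  obtain K K' where K: "K \<in> imag_units" "y = of_real \<alpha> + \<beta> *\<^sub>R K"
    and K': "K' \<in> imag_units" "y' = of_real \<alpha> + \<beta> *\<^sub>R K'"
    using y(1) y'(1) unfolding xeq sph_eq[OF J] by blast
  have "K = K'"
  proof (rule imag_root_unique)
    show "\<not> (primal (part1 (F (Complex \<alpha> \<beta>))) = 0 \<and> primal (part2 (F (Complex \<alpha> \<beta>))) = 0)"
      using primal primal_fun_vanishes_iff[OF F z J] by (simp add: xeq fF)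
  qed (use slice_of_eq[OF F z] K K' y(2) y'(2) in \<open>simp_all add: fF\<close>)
  then show ?thesis
    using K K' by simp
qed

theorem theorem5p6:
  fixes D :: "complex set" and f :: "dquat \<Rightarrow> dquat"
  assumes "cnj ` D = D"
    and "f \<in> slice_functions D"
  shows "zeros (circ D) (normal_fun D f) =
      (\<Union>x\<in>{x \<in> circ D. zeros (circ D) f \<inter> sph x \<noteq> {}}. sph x)
    \<union> (\<Union>x\<in>{x \<in> circ D. sph x \<inter> quats \<subseteq> zeros (circ D \<inter> quats) (primal_fun D f)}. sph x)
    \<and> (\<forall>x \<in> circ D - \<real>.
        (\<forall>y\<in>sph x. normal_fun D f y = 0) \<longleftrightarrow>
          (\<exists>!y. y \<in> sph x \<and> f y = 0) \<or> (\<forall>y \<in> sph x \<inter> quats. primal_fun D f y = 0))"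
proof (intro conjI ballI)
  note iff = normal_fun_eq_0_iff_sph[OF assms]
  \<comment> \<open>Membership in \<open>zeros\<close> includes the domain; as the sphere lies in
    \<open>circ D\<close>, only the conditions on values remain.\<close>
  have f_zero: "zeros (circ D) f \<inter> sph x \<noteq> {} \<longleftrightarrow> (\<exists>y\<in>sph x. f y = 0)"
    and primal_zero: "sph x \<inter> quats \<subseteq> zeros (circ D \<inter> quats) (primal_fun D f) \<longleftrightarrow>
      (\<forall>y \<in> sph x \<inter> quats. primal_fun D f y = 0)" if "x \<in> circ D" for x
    using sph_subset_circ[OF that] by (auto simp: zeros_def)
  \<comment> \<open>Both alternatives in \<open>iff\<close> depend on the sphere only, so each zero
    brings its whole sphere with it.\<close>
  have "zeros (circ D) (normal_fun D f) = (\<Union>x\<in>{x \<in> circ D. normal_fun D f x = 0}. sph x)"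
  proof (intro equalityI subsetI)
    fix y assume "y \<in> (\<Union>x\<in>{x \<in> circ D. normal_fun D f x = 0}. sph x)"
    then obtain x where x: "x \<in> circ D" "normal_fun D f x = 0" "y \<in> sph x"
      by blast
    then have "y \<in> circ D"
      using sph_subset_circ by blast
    then show "y \<in> zeros (circ D) (normal_fun D f)"
      using iff[of x] iff[of y] x sph_cong[OF x(1,3)] by (simp add: zeros_def)
  qed (auto simp: zeros_def intro: mem_sph_self)
  also have "{x \<in> circ D. normal_fun D f x = 0} =
      {x \<in> circ D. zeros (circ D) f \<inter> sph x \<noteq> {}} \<union>
      {x \<in> circ D. sph x \<inter> quats \<subseteq> zeros (circ D \<inter> quats) (primal_fun D f)}"
    using iff f_zero primal_zero by blast
  finally show "zeros (circ D) (normal_fun D f) =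
      (\<Union>x\<in>{x \<in> circ D. zeros (circ D) f \<inter> sph x \<noteq> {}}. sph x)
    \<union> (\<Union>x\<in>{x \<in> circ D. sph x \<inter> quats \<subseteq> zeros (circ D \<inter> quats) (primal_fun D f)}. sph x)"
    by (simp only: UN_Un)
  fix x assume "x \<in> circ D - \<real>"
  then have x: "x \<in> circ D"
    by simp
  have "(\<forall>y\<in>sph x. normal_fun D f y = 0) \<longleftrightarrow> normal_fun D f x = 0"
    using iff sph_cong[OF x] sph_subset_circ[OF x] mem_sph_self[OF x] by (metis subsetD)
  \<comment> \<open>Existence and unique existence differ only when f has several zeros on the
    sphere, and \<open>zero_unique_on_sph\<close> then yields the second alternative.\<close>
  then show "(\<forall>y\<in>sph x. normal_fun D f y = 0) \<longleftrightarrow>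
      (\<exists>!y. y \<in> sph x \<and> f y = 0) \<or> (\<forall>y \<in> sph x \<inter> quats. primal_fun D f y = 0)"
    using iff[OF x] zero_unique_on_sph[OF assms(2) x] by blast
qed

end
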